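(* $\mathfrak e\ge\min\{\mathfrak e(\omega),\mathrm{cov}(\mathcal M)\}$. Consequently, if either $\mathfrak e<\mathrm{cov}(\mathcal M)$ or $\mathfrak e(\omega)\le\mathrm{cov}(\mathcal M)$, then $\mathfrak e=\mathfrak e(\omega)$.
   Context: An $\omega$-valued predictor is $\pi=(D_\pi,\langle\pi_n:n\in D_\pi\rangle)$ with $D_\pi\subseteq\omega$ infinite and $\pi_n:\omega^n\to\omega$; $\pi$ predicts $f\in\omega^\omega$ if $f(n)=\pi_n(f\restriction n)$ for all but finitely many $n\in D_\pi$, otherwise $f$ evades $\pi$. $\mathfrak e$ is the least size of $\mathcal F\subseteq\omega^\omega$ such that no single predictor predicts all members of $\mathcal F$. $\mathfrak e(\omega)$ is the least size of $\mathcal F\subseteq\omega^\omega$ such that for every countable family $\Pi$ of predictors there is $f\in\mathcal F$ evading all $\pi\in\Pi$ (one has $\mathfrak e\le\mathfrak e(\omega)$). $\mathrm{cov}(\mathcal M)$ is the least size of a family of meager subsets of $\omega^\omega$ whose union is $\omega^\omega$. *)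

theory Defs
  imports "HOL-Analysis.Analysis"
begin

unbundle cardinal_syntax

section \<open>Cardinals\<close>

text \<open>
  Cardinals are represented, as in the library, by cardinal orders, compared by \<open>\<le>o\<close>, \<open><o\<close>, \<open>=o\<close>
  (which may relate orders on different types).
  \<open>least_card P\<close> is meaningful whenever some set satisfies \<open>P\<close>: see \<open>least_card_attained\<close>.
\<close>

definition least_card :: "('a set \<Rightarrow> bool) \<Rightarrow> 'a rel" where
  "least_card P = |SOME A. P A \<and> (\<forall>B. P B \<longrightarrow> |A| \<le>o |B| )|"

lemma least_card_attained:
  assumes "P B"
  shows "\<exists>A. P A \<and> least_card P = |A| \<and> (\<forall>C. P C \<longrightarrow> |A| \<le>o |C| )"
proof -
  have "\<exists>A. P A \<and> (\<forall>C. P C \<longrightarrow> |A| \<le>o |C| )"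
    using exists_minim_Card_order[of "card_of ` Collect P"] assms card_of_Card_order by blast
  from someI_ex[OF this] show ?thesis
    unfolding least_card_def by blast
qed

text \<open>
  The two arguments may live on different types, so the smaller one is copied along an injection
  into the sum type; \<open>card_min_ordIso\<close> shows that this leaves the cardinal unchanged.
\<close>

definition card_min :: "'a rel \<Rightarrow> 'b rel \<Rightarrow> ('a + 'b) rel" where
  "card_min r s = (if r \<le>o s then dir_image r Inl else dir_image s Inr)"

lemma card_min_ordIso:
  assumes "Well_order r" "Well_order s"
  shows "r \<le>o s \<Longrightarrow> card_min r s =o r" "s \<le>o r \<Longrightarrow> card_min r s =o s"
proof -
  have l: "dir_image r (Inl :: 'a \<Rightarrow> 'a + 'b) =o r" and r: "dir_image s (Inr :: 'b \<Rightarrow> 'a + 'b) =o s"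
    using assms by (auto intro!: ordIso_symmetric[OF dir_image_ordIso])
  show "r \<le>o s \<Longrightarrow> card_min r s =o r"
    using l by (simp add: card_min_def)
  show "s \<le>o r \<Longrightarrow> card_min r s =o s"
    using l r by (auto simp: card_min_def intro: ordIso_transitive dest: ordIso_iff_ordLeq[THEN iffD2, OF conjI])
qed


section \<open>Predictors\<close>

text \<open>
  Elements of \<open>\<omega>\<^sup>n\<close> are lists of length \<open>n\<close>. A predictor is a pair \<open>(D, p)\<close>; only the values of
  \<open>p n\<close> on lists of length \<open>n\<close>, for \<open>n \<in> D\<close>, are ever used.
\<close>

type_synonym predictor = "nat set \<times> (nat \<Rightarrow> nat list \<Rightarrow> nat)"

definition is_predictor :: "predictor \<Rightarrow> bool" where
  "is_predictor \<pi> \<longleftrightarrow> infinite (fst \<pi>)"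

definition initial_segment :: "(nat \<Rightarrow> nat) \<Rightarrow> nat \<Rightarrow> nat list" where
  "initial_segment f n = map f [0..<n]"

definition predicts :: "predictor \<Rightarrow> (nat \<Rightarrow> nat) \<Rightarrow> bool" where
  "predicts \<pi> f \<longleftrightarrow> finite {n \<in> fst \<pi>. f n \<noteq> snd \<pi> n (initial_segment f n)}"

abbreviation evades :: "(nat \<Rightarrow> nat) \<Rightarrow> predictor \<Rightarrow> bool" where
  "evades f \<pi> \<equiv> \<not> predicts \<pi> f"

definition evasion_number :: "(nat \<Rightarrow> nat) rel" where
  "evasion_number =
     least_card (\<lambda>F. \<not> (\<exists>\<pi>. is_predictor \<pi> \<and> (\<forall>f\<in>F. predicts \<pi> f)))"

definition evasion_number_omega :: "(nat \<Rightarrow> nat) rel" where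
  "evasion_number_omega =
     least_card (\<lambda>F. \<forall>P. countable P \<and> (\<forall>\<pi>\<in>P. is_predictor \<pi>) \<longrightarrow>
                          (\<exists>f\<in>F. \<forall>\<pi>\<in>P. evades f \<pi>))"


section \<open>Category\<close>

definition nowhere_dense :: "'a::topological_space set \<Rightarrow> bool" where
  "nowhere_dense A \<longleftrightarrow> interior (closure A) = {}"

definition meager :: "'a::topological_space set \<Rightarrow> bool" where
  "meager A \<longleftrightarrow> (\<exists>\<N>. countable \<N> \<and> (\<forall>N\<in>\<N>. nowhere_dense N) \<and> A = \<Union>\<N>)"

text \<open>The topology on \<^typ>\<open>nat \<Rightarrow> nat\<close> is the product topology of discrete factors.\<close>

definition cov_meager :: "(nat \<Rightarrow> nat) set rel" where
  "cov_meager = least_card (\<lambda>\<A>. (\<forall>A\<in>\<A>. meager A) \<and> \<Union>\<A> = UNIV)"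

end

theory Submission
  imports Defs
begin

text \<open>
  Let \<open>F\<close> have size less than both \<open>\<ee>(\<omega>)\<close> and \<open>cov(\<M>)\<close>. For every infinite \<open>D\<close>, countably many
  predictors with domain inside \<open>D\<close> suffice to predict all of \<open>F\<close>: replace \<open>f\<close> by the function mapping
  \<open>i\<close> to the initial segment of \<open>f\<close> up to and including the \<open>i\<close>-th element of \<open>D\<close>. Iterating this
  yields an \<open>\<omega>\<close>-branching tree of predictors whose domains decrease along branches, such that every
  \<open>f \<in> F\<close> is predicted by some child of every node. For each \<open>f\<close>, the branches none of whose nodes
  predict \<open>f\<close> form a nowhere dense set, so a single branch works for all of \<open>F\<close>. Finally, the
  predictors along that branch merge into one: its domain is a pseudo-intersection of their domains,
  and it always follows the first predictor not yet refuted.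
\<close>

section \<open>Predictors\<close>

lemma length_initial_segment [simp]: "length (initial_segment f n) = n"
  by (simp add: initial_segment_def)

lemma nth_initial_segment [simp]: "i < n \<Longrightarrow> initial_segment f n ! i = f i"
  by (simp add: initial_segment_def)

lemma take_initial_segment [simp]: "m \<le> n \<Longrightarrow> take m (initial_segment f n) = initial_segment f m"
  by (simp add: initial_segment_def take_map)

lemma last_initial_segment [simp]: "last (initial_segment f (Suc n)) = f n"
  by (simp add: initial_segment_def)

lemma predicts_iff:
  "predicts \<pi> f \<longleftrightarrow> (\<exists>m. \<forall>n\<in>fst \<pi>. m \<le> n \<longrightarrow> f n = snd \<pi> n (initial_segment f n))"
  unfolding predicts_def finite_nat_set_iff_bounded by (simp add: Ball_def) (metis not_le)

text \<open>Diagonalisation: the value at n exceeds every guess of the first n+1 predictors, so the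
  j-th one errs at each n \<ge> j in its domain. Hence \<open>UNIV\<close> satisfies the conditions
  defining both evasion numbers, and their minima are attained.\<close>

lemma exists_evading_countable:
  assumes "countable P" and pred: "\<forall>\<pi>\<in>P. is_predictor \<pi>"
  shows "\<exists>f. \<forall>\<pi>\<in>P. evades f \<pi>"
proof (cases "P = {}")
  case False
  define q where "q = from_nat_into P"
  define next_value where "next_value n s = Suc (\<Sum>j\<le>n. snd (q j) n s)" for n s
  define seg where "seg = rec_nat [] (\<lambda>n s. s @ [next_value n s])"
  define f where "f n = next_value n (seg n)" for n
  have seg: "seg n = initial_segment f n" for n
    by (induction n) (simp_all add: seg_def initial_segment_def f_def)
  have "evades f (q j)" for j
  proof
    assume "predicts (q j) f"
    then obtain m where m: "\<forall>n\<in>fst (q j). m \<le> n \<longrightarrow> f n = snd (q j) n (initial_segment f n)"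
      by (auto simp: predicts_iff)
    have "infinite (fst (q j))"
      using pred from_nat_into[OF False, of j] by (simp add: q_def is_predictor_def)
    then obtain n where n: "n \<in> fst (q j)" "max m j \<le> n"
      unfolding infinite_nat_iff_unbounded_le by blast
    have "snd (q j) n (seg n) \<le> (\<Sum>j\<le>n. snd (q j) n (seg n))"
      using n by (intro member_le_sum) auto
    then have "snd (q j) n (seg n) < f n"
      by (simp add: f_def next_value_def)
    with m n show False by (simp add: seg)
  qed
  moreover have "\<exists>j. \<pi> = q j" if "\<pi> \<in> P" for \<pi>
    using from_nat_into_surj[OF \<open>countable P\<close> that] by (auto simp: q_def)
  ultimately show ?thesis by metis
qed simp

text \<open>A correct guess of \<open>coded f i\<close> reveals f up to and including the i-th
  element of D, in particular its value there. The history
  \<open>coded f 0, ..., coded f (i-1)\<close> that \<open>\<rho>\<close> needs depends only on f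
  below that element.\<close>

lemma predictor_of_coded_predictor:
  fixes \<rho> :: predictor and D :: "nat set"
  assumes D: "infinite D" and \<rho>: "is_predictor \<rho>"
  defines "coded \<equiv> \<lambda>f i. to_nat (initial_segment f (Suc (enumerate D i)))"
  shows "\<exists>\<pi>. is_predictor \<pi> \<and> fst \<pi> \<subseteq> D \<and> (\<forall>f. predicts \<rho> (coded f) \<longrightarrow> predicts \<pi> f)"
proof -
  define d where "d = enumerate D"
  have mono: "strict_mono d"
    using D by (simp add: d_def strict_mono_enumerate)
  then have inj: "inj d" by (rule strict_mono_imp_inj_on)
  \<comment> \<open>For \<open>n = d i\<close>, the entries \<open>coded f j\<close> with j < i are
    rebuilt from prefixes of s, which is long enough because \<open>d j < d i\<close>; the last
    entry of the decoded guess is the guess for \<open>f (d i)\<close>.\<close>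
  define p where
    "p n s = (let i = inv d n in
       last (from_nat (snd \<rho> i (map (\<lambda>j. to_nat (take (Suc (d j)) s)) [0..<i])) :: nat list))"
    for n and s :: "nat list"
  define \<pi> where "\<pi> = (d ` fst \<rho>, p)"
  have "is_predictor \<pi>"
    using \<rho> inj by (auto simp: \<pi>_def is_predictor_def finite_image_iff inj_on_def)
  moreover have "fst \<pi> \<subseteq> D"
    using enumerate_in_set[OF D] by (auto simp: \<pi>_def d_def)
  moreover have "predicts \<pi> f" if pf: "predicts \<rho> (coded f)" for f
  proof -
    obtain m where
      m: "\<And>i. i \<in> fst \<rho> \<Longrightarrow> m \<le> i \<Longrightarrow> coded f i = snd \<rho> i (initial_segment (coded f) i)"
      using pf by (auto simp: predicts_iff)
    have "f (d i) = p (d i) (initial_segment f (d i))" if i: "i \<in> fst \<rho>" "d m \<le> d i" for i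
    proof -
      have "map (\<lambda>j. to_nat (take (Suc (d j)) (initial_segment f (d i)))) [0..<i]
          = initial_segment (coded f) i"
        unfolding initial_segment_def[of "coded f"]
        using strict_monoD[OF mono] by (intro map_cong) (auto simp: coded_def d_def Suc_le_eq)
      moreover have "m \<le> i"
        using i mono by (simp add: strict_mono_less_eq)
      ultimately have "p (d i) (initial_segment f (d i)) = last (from_nat (coded f i) :: nat list)"
        using m[OF i(1)] by (simp add: p_def inv_f_f[OF inj])
      then show ?thesis by (simp add: coded_def d_def)
    qed
    then show ?thesis
      by (auto simp: predicts_iff \<pi>_def)
  qed
  ultimately show ?thesis by blast
qed

text \<open>As the domains decrease, a set with i-th element in the i-th domain is almost contained
  in each of them. A refuted conjecture stays refuted, so along a predicted f the least surviving
  conjecture stabilises at a true one.\<close>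

lemma merge_decreasing_predictors:
  fixes \<pi> :: "nat \<Rightarrow> predictor"
  assumes inf: "\<And>k. is_predictor (\<pi> k)" and dec: "\<And>k. fst (\<pi> (Suc k)) \<subseteq> fst (\<pi> k)"
  shows "\<exists>\<rho>. is_predictor \<rho> \<and> (\<forall>f k. predicts (\<pi> k) f \<longrightarrow> predicts \<rho> f)"
proof -
  have anti: "fst (\<pi> k) \<subseteq> fst (\<pi> l)" if "l \<le> k" for k l
    using dec that by (rule lift_Suc_antimono_le)
  have "\<exists>d. \<forall>i. d i \<in> fst (\<pi> i) \<and> d i < d (Suc i)"
  proof (rule dependent_nat_choice)
    show "\<exists>x. x \<in> fst (\<pi> 0)"
      using inf[of 0] by (auto simp: is_predictor_def dest: infinite_imp_nonempty)
    show "\<exists>y. y \<in> fst (\<pi> (Suc i)) \<and> x < y" for x i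
      using inf[of "Suc i"] by (auto simp: is_predictor_def infinite_nat_iff_unbounded)
  qed
  then obtain d where d: "\<And>i. d i \<in> fst (\<pi> i)" and "\<And>i. d i < d (Suc i)" by blast
  then have mono: "strict_mono d" by (simp add: strict_mono_Suc_iff)
  \<comment> \<open>The index \<open>j\<close> codes a pair \<open>(k, m)\<close>, read as the conjecture that \<open>\<pi> k\<close> errs nowhere beyond \<open>m\<close>.\<close>
  define errs where "errs j f n \<longleftrightarrow> (case prod_decode j of (k, m) \<Rightarrow>
      n \<in> fst (\<pi> k) \<and> m \<le> n \<and> f n \<noteq> snd (\<pi> k) n (initial_segment f n))" for j f n
  \<comment> \<open>An error at n < \<open>length s\<close> involves only entries of s up to n, so
    \<open>(!) s\<close> is never consulted beyond the list. Some conjecture always survives s: any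
    pair with m \<ge> \<open>length s\<close>.\<close>
  define alive where "alive j s \<longleftrightarrow> (\<forall>n<length s. \<not> errs j ((!) s) n)" for j s
  define p where "p n s = snd (\<pi> (fst (prod_decode (LEAST j. alive j s)))) n s" for n s
  define \<rho> where "\<rho> = (range d, p)"
  have "is_predictor \<rho>"
    using range_inj_infinite[OF strict_mono_imp_inj_on[OF mono]]
    by (simp add: \<rho>_def is_predictor_def)
  moreover have "predicts \<rho> f" if pf: "predicts (\<pi> k) f" for f k
  proof -
    have seg: "initial_segment ((!) (initial_segment f N)) n = initial_segment f n" if "n \<le> N" for n N
      using that by (simp add: initial_segment_def)
    have alive_iff: "alive j (initial_segment f N) \<longleftrightarrow> (\<forall>n<N. \<not> errs j f n)" for j N
      by (auto simp: alive_def errs_def seg split: prod.splits)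
    define j where "j = (LEAST j. \<forall>n. \<not> errs j f n)"
    have "\<exists>j. \<forall>n. \<not> errs j f n"
    proof -
      obtain m where "\<forall>n\<in>fst (\<pi> k). m \<le> n \<longrightarrow> f n = snd (\<pi> k) n (initial_segment f n)"
        using pf by (auto simp: predicts_iff)
      then have "\<forall>n. \<not> errs (prod_encode (k, m)) f n"
        by (auto simp: errs_def)
      then show ?thesis by blast
    qed
    then have j: "\<And>n. \<not> errs j f n"
      unfolding j_def by (rule LeastI2_ex) blast
    have "\<forall>l<j. \<exists>n. errs l f n"
      unfolding j_def using not_less_Least by blast
    then obtain e where e: "\<And>l. l < j \<Longrightarrow> errs l f (e l)" by metis
    obtain k' m' where km: "prod_decode j = (k', m')" by fastforce
    \<comment> \<open>Past M, all conjectures before j have been refuted, the bound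
      \<open>m'\<close> of conjecture j has been reached, and the points \<open>d i\<close> lie in
      the domain of \<open>\<pi> k'\<close>.\<close>
    define M where "M = Max (e ` {..<j} \<union> {m', d k'})"
    have M: "e l \<le> M" if "l < j" for l
      using that unfolding M_def by (intro Max_ge) auto
    have M': "m' \<le> M" "d k' \<le> M"
      unfolding M_def by (intro Max_ge; auto)+
    \<comment> \<open>The inequality must be strict: the segment of length \<open>d i\<close> shows
      the error at \<open>e l\<close> only if \<open>e l < d i\<close>.\<close>
    have "f (d i) = p (d i) (initial_segment f (d i))" if i: "Suc M \<le> d i" for i
    proof -
      have "(LEAST l. alive l (initial_segment f (d i))) = j"
      proof (rule Least_equality)
        show "alive j (initial_segment f (d i))"
          using j by (simp add: alive_iff)
        show "j \<le> l" if "alive l (initial_segment f (d i))" for l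
          using that e[of l] M[of l] i unfolding alive_iff by (meson leI le_less_trans Suc_le_lessD)
      qed
      moreover have "d k' \<le> d i" using i M' by simp
      then have "k' \<le> i" using mono by (simp add: strict_mono_less_eq)
      then have "d i \<in> fst (\<pi> k')" using d anti by blast
      ultimately show ?thesis
        using j[of "d i"] i M' by (auto simp: errs_def km p_def)
    qed
    then show ?thesis
      by (auto simp: predicts_iff \<rho>_def)
  qed
  ultimately show ?thesis by blast
qed

section \<open>Category in the Baire space\<close>

lemma open_cylinder: "open {g :: nat \<Rightarrow> nat. \<forall>i<n. g i = c i}"
proof -
  have "{g. \<forall>i<n. g i = c i} = Pi\<^sub>E UNIV (\<lambda>i. if i < n then {c i} else UNIV)"
    by (auto simp: PiE_iff split: if_splits)
  moreover have "open \<dots>"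
    by (rule open_PiE) (auto simp: open_discrete intro: finite_subset[of _ "{..<n}"])
  ultimately show ?thesis by simp
qed

lemma open_contains_cylinder:
  assumes "open U" "c \<in> (U :: (nat \<Rightarrow> nat) set)"
  obtains n where "{g. \<forall>i<n. g i = c i} \<subseteq> U"
proof -
  obtain X where X: "c \<in> Pi\<^sub>E UNIV X" "finite {i. X i \<noteq> UNIV}" "Pi\<^sub>E UNIV X \<subseteq> U"
    using product_topology_open_contains_basis[of "\<lambda>_. euclidean" UNIV U c] assms
    by (auto simp: open_fun_def)
  obtain n where n: "\<forall>i\<in>{i. X i \<noteq> UNIV}. i < n"
    using X(2) finite_nat_set_iff_bounded by blast
  have "{g. \<forall>i<n. g i = c i} \<subseteq> Pi\<^sub>E UNIV X"
  proof
    fix g assume g: "g \<in> {g. \<forall>i<n. g i = c i}"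
    have "g i \<in> X i" for i
      using g n X(1) by (cases "i < n") (auto simp: PiE_iff)
    then show "g \<in> Pi\<^sub>E UNIV X" by auto
  qed
  also note X(3)
  finally show thesis by (rule that)
qed

text \<open>Each basic cylinder contains a point c' with a neighbourhood missing A, so no cylinder
  lies in the closure of A.\<close>

lemma nowhere_dense_if_avoidable:
  fixes A :: "(nat \<Rightarrow> nat) set"
  assumes "\<And>c n. \<exists>c' m. (\<forall>i<n. c' i = c i) \<and> (\<forall>g\<in>A. \<exists>i<m. g i \<noteq> c' i)"
  shows "nowhere_dense A"
proof -
  have False if c: "c \<in> interior (closure A)" for c
  proof -
    obtain n where n: "{g. \<forall>i<n. g i = c i} \<subseteq> interior (closure A)"
      using open_contains_cylinder[OF open_interior c] .
    obtain c' m where c': "\<forall>i<n. c' i = c i" and m: "\<forall>g\<in>A. \<exists>i<m. g i \<noteq> c' i"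
      using assms by blast
    have "c' \<in> closure A" using n c' interior_subset by blast
    moreover have "{g. \<forall>i<m. g i = c' i} \<inter> A = {}" using m by auto
    ultimately show False
      using open_Int_closure_eq_empty[OF open_cylinder, of m c' A] by auto
  qed
  then show ?thesis by (auto simp: nowhere_dense_def)
qed

lemma meager_if_nowhere_dense: "nowhere_dense A \<Longrightarrow> meager A"
  unfolding meager_def by (intro exI[of _ "{A}"]) auto

text \<open>A point c of the Baire space is a branch choosing child \<open>c n\<close> at level n;
  \<open>noncover\<close> is the form in which |F| < cov(M) enters.\<close>

lemma exists_generic_branch:
  fixes F :: "(nat \<Rightarrow> nat) set" and q :: "predictor \<Rightarrow> nat \<Rightarrow> predictor"
  assumes noncover: "\<And>A :: _ \<Rightarrow> (nat \<Rightarrow> nat) set. (\<And>f. f \<in> F \<Longrightarrow> meager (A f)) \<Longrightarrow> (\<Union>f\<in>F. A f) \<noteq> UNIV"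
    and q: "\<And>\<pi>. is_predictor \<pi> \<Longrightarrow> (\<forall>k. is_predictor (q \<pi> k)) \<and> (\<forall>f\<in>F. \<exists>k. predicts (q \<pi> k) f)"
    and root: "is_predictor \<pi>\<^sub>0"
  shows "\<exists>c. \<forall>f\<in>F. \<exists>n. predicts (rec_nat \<pi>\<^sub>0 (\<lambda>n \<pi>. q \<pi> (c n)) n) f"
proof -
  define node where "node c = rec_nat \<pi>\<^sub>0 (\<lambda>n \<pi>. q \<pi> (c n))" for c :: "nat \<Rightarrow> nat"
  have node_Suc: "node c (Suc n) = q (node c n) (c n)" for c n
    by (simp add: node_def)
  have node_pred: "is_predictor (node c n)" for c n
    by (induction n) (use root q in \<open>auto simp: node_def\<close>)
  have node_cong: "node c n = node c' n" if "\<forall>i<n. c i = c' i" for c c' n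
    using that by (induction n) (auto simp: node_def)
  define A where "A f = {c. \<forall>n. \<not> predicts (node c n) f}" for f
  have "meager (A f)" if f: "f \<in> F" for f
  proof (intro meager_if_nowhere_dense nowhere_dense_if_avoidable)
    fix c :: "nat \<Rightarrow> nat" and n
    obtain k where k: "predicts (q (node c n) k) f"
      using q[OF node_pred] f by blast
    \<comment> \<open>Altering only choice n keeps the node at level n and steps from it to a child
      that predicts f.\<close>
    define c' where "c' = c(n := k)"
    have "node c' n = node c n" by (rule node_cong) (simp add: c'_def)
    then have "predicts (node c' (Suc n)) f"
      using k by (simp add: node_Suc c'_def)
    \<comment> \<open>A branch sharing the first n+1 choices of c' would pass through that
      predicting node.\<close>
    then have "\<forall>g\<in>A f. \<exists>i<Suc n. g i \<noteq> c' i"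
      using node_cong[of "Suc n" _ c'] unfolding A_def by (metis (mono_tags, lifting) mem_Collect_eq)
    then show "\<exists>c' m. (\<forall>i<n. c' i = c i) \<and> (\<forall>g\<in>A f. \<exists>i<m. g i \<noteq> c' i)"
      by (intro exI[of _ c'] exI[of _ "Suc n"]) (simp add: c'_def)
  qed
  then have "(\<Union>f\<in>F. A f) \<noteq> UNIV" by (intro noncover)
  then show ?thesis by (auto simp: A_def node_def)
qed

section \<open>The cardinal invariants\<close>

lemma least_card_le: "P A \<Longrightarrow> least_card P \<le>o |A|"
  using least_card_attained[of P A] by auto

lemma countable_predictors:
  assumes "|F| <o evasion_number_omega"
  shows "\<exists>P. countable P \<and> (\<forall>\<pi>\<in>P. is_predictor \<pi>) \<and> (\<forall>f\<in>F. \<exists>\<pi>\<in>P. predicts \<pi> f)"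
proof (rule ccontr)
  assume "\<not> ?thesis"
  then have "evasion_number_omega \<le>o |F|"
    unfolding evasion_number_omega_def by (intro least_card_le) meson
  with assms show False by (simp add: not_ordLess_ordLeq)
qed

lemma cov_meager_le:
  fixes \<A> :: "(nat \<Rightarrow> nat) set set"
  assumes "\<And>A. A \<in> \<A> \<Longrightarrow> meager A" "\<Union>\<A> = UNIV"
  shows "cov_meager \<le>o |\<A>|"
  unfolding cov_meager_def by (rule least_card_le) (use assms in blast)

lemma evasion_number_attained:
  "\<exists>F. evasion_number = |F| \<and> \<not> (\<exists>\<pi>. is_predictor \<pi> \<and> (\<forall>f\<in>F. predicts \<pi> f))"
proof -
  let ?Q = "\<lambda>F. \<not> (\<exists>\<pi>. is_predictor \<pi> \<and> (\<forall>f\<in>F. predicts \<pi> f))"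
  have "?Q UNIV"
    using exists_evading_countable[of "{\<pi>}" for \<pi>] by fastforce
  from least_card_attained[of ?Q, OF this] show ?thesis
    unfolding evasion_number_def by blast
qed

text \<open>A family that handles all countable sets of predictors handles singletons.\<close>

lemma evasion_number_le_omega: "evasion_number \<le>o evasion_number_omega"
proof -
  let ?Q = "\<lambda>F. \<forall>P. countable P \<and> (\<forall>\<pi>\<in>P. is_predictor \<pi>) \<longrightarrow> (\<exists>f\<in>F. \<forall>\<pi>\<in>P. evades f \<pi>)"
  have "?Q UNIV" using exists_evading_countable by simp
  from least_card_attained[of ?Q, OF this]
  obtain F where F: "evasion_number_omega = |F|" "?Q F"
    unfolding evasion_number_omega_def by blast
  have "\<exists>f\<in>F. evades f \<pi>" if "is_predictor \<pi>" for \<pi>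
    using F(2)[rule_format, of "{\<pi>}"] that by simp
  then show ?thesis
    unfolding F(1) evasion_number_def by (intro least_card_le) blast
qed

lemma Well_order_evasion_number: "Well_order evasion_number"
  by (simp add: evasion_number_def least_card_def card_of_Well_order)

lemma Well_order_evasion_number_omega: "Well_order evasion_number_omega"
  by (simp add: evasion_number_omega_def least_card_def card_of_Well_order)

lemma Well_order_cov_meager: "Well_order cov_meager"
  by (simp add: cov_meager_def least_card_def card_of_Well_order)

text \<open>The coded family is no larger than F, so countably many predictors cover it; decoding
  them forces their domains into D.\<close>

lemma predictors_within:
  assumes F: "|F| <o evasion_number_omega" and D: "infinite D"
  shows "\<exists>q :: nat \<Rightarrow> predictor. (\<forall>k. is_predictor (q k) \<and> fst (q k) \<subseteq> D) \<and>
    (\<forall>f\<in>F. \<exists>k. predicts (q k) f)"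
proof -
  define coded where "coded f i = to_nat (initial_segment f (Suc (enumerate D i)))"
    for f :: "nat \<Rightarrow> nat" and i
  have "|coded ` F| <o evasion_number_omega"
    using card_of_image F by (rule ordLeq_ordLess_trans)
  from countable_predictors[OF this]
  obtain P where P: "countable P" "\<forall>\<rho>\<in>P. is_predictor \<rho>"
      and cover: "\<forall>f\<in>F. \<exists>\<rho>\<in>P. predicts \<rho> (coded f)"
    by auto
  \<comment> \<open>The dummy predictor makes the set nonempty, so that \<open>from_nat_into\<close>
    enumerates it even if P is empty.\<close>
  define P' where "P' = insert (UNIV, \<lambda>_ _. 0) P"
  have P': "P' \<noteq> {}" "countable P'" "\<forall>\<rho>\<in>P'. is_predictor \<rho>"
    using P by (auto simp: P'_def is_predictor_def)
  have "\<exists>\<pi>. is_predictor \<pi> \<and> fst \<pi> \<subseteq> D \<and>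
      (\<forall>f. predicts (from_nat_into P' k) (coded f) \<longrightarrow> predicts \<pi> f)" for k
    unfolding coded_def
    by (rule predictor_of_coded_predictor[OF D]) (use P'(3) from_nat_into[OF P'(1)] in simp)
  then obtain q where q: "\<And>k. is_predictor (q k) \<and> fst (q k) \<subseteq> D \<and>
      (\<forall>f. predicts (from_nat_into P' k) (coded f) \<longrightarrow> predicts (q k) f)"
    by metis
  have "\<exists>k. predicts (q k) f" if "f \<in> F" for f
  proof -
    obtain \<rho> where mem: "\<rho> \<in> P'" and \<rho>: "predicts \<rho> (coded f)"
      using cover \<open>f \<in> F\<close> unfolding P'_def by blast
    obtain k where "from_nat_into P' k = \<rho>"
      using from_nat_into_surj[OF P'(2) mem] by blast
    then show ?thesis using q[of k] \<rho> by auto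
  qed
  then show ?thesis using q by blast
qed

lemma exists_single_predictor:
  assumes F: "|F| <o evasion_number_omega" "|F| <o cov_meager"
  shows "\<exists>\<pi>. is_predictor \<pi> \<and> (\<forall>f\<in>F. predicts \<pi> f)"
proof -
  \<comment> \<open>The hypothesis on \<open>\<pi>\<close> sits inside the existential so that
    choice yields one child function defined on all pairs.\<close>
  have "\<forall>\<pi>. \<exists>q :: nat \<Rightarrow> predictor. is_predictor \<pi> \<longrightarrow>
      (\<forall>k. is_predictor (q k) \<and> fst (q k) \<subseteq> fst \<pi>) \<and> (\<forall>f\<in>F. \<exists>k. predicts (q k) f)"
    using predictors_within[OF F(1)] unfolding is_predictor_def by blast
  then obtain q :: "predictor \<Rightarrow> nat \<Rightarrow> predictor" where q: "\<And>\<pi>. is_predictor \<pi> \<Longrightarrow>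
      (\<forall>k. is_predictor (q \<pi> k) \<and> fst (q \<pi> k) \<subseteq> fst \<pi>) \<and> (\<forall>f\<in>F. \<exists>k. predicts (q \<pi> k) f)"
    by metis
  define root :: predictor where "root = (UNIV, \<lambda>_ _. 0)"
  have root: "is_predictor root" by (simp add: root_def is_predictor_def)
  have "\<exists>c. \<forall>f\<in>F. \<exists>n. predicts (rec_nat root (\<lambda>n \<pi>. q \<pi> (c n)) n) f"
  proof (rule exists_generic_branch[OF _ _ root])
    show "(\<Union>f\<in>F. A f) \<noteq> UNIV" if "\<And>f. f \<in> F \<Longrightarrow> meager (A f)"
      for A :: "_ \<Rightarrow> (nat \<Rightarrow> nat) set"
    proof
      assume "(\<Union>f\<in>F. A f) = UNIV"
      then have "cov_meager \<le>o |A ` F|"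
        using that by (intro cov_meager_le) auto
      also have "|A ` F| \<le>o |F|" by (rule card_of_image)
      finally show False using F(2) not_ordLess_ordLeq by blast
    qed
  qed (use q in blast)
  then obtain c where c: "\<forall>f\<in>F. \<exists>n. predicts (rec_nat root (\<lambda>n \<pi>. q \<pi> (c n)) n) f" ..
  define node where "node = rec_nat root (\<lambda>n \<pi>. q \<pi> (c n))"
  have pred: "is_predictor (node n)" for n
    by (induction n) (use root q in \<open>auto simp: node_def\<close>)
  moreover have "fst (node (Suc n)) \<subseteq> fst (node n)" for n
    using q[OF pred[of n]] by (simp add: node_def)
  ultimately show ?thesis
    using merge_decreasing_predictors[of node] c unfolding node_def by blast
qed

lemma omega_le_or_cov_le:
  "evasion_number_omega \<le>o evasion_number \<or> cov_meager \<le>o evasion_number"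
proof -
  obtain F where F: "evasion_number = |F|" "\<not> (\<exists>\<pi>. is_predictor \<pi> \<and> (\<forall>f\<in>F. predicts \<pi> f))"
    using evasion_number_attained by blast
  then have "\<not> ( |F| <o evasion_number_omega \<and> |F| <o cov_meager)"
    using exists_single_predictor by blast
  then show ?thesis
    using F(1) Well_order_evasion_number Well_order_evasion_number_omega Well_order_cov_meager
      not_ordLess_iff_ordLeq by metis
qed

lemma card_min_le:
  assumes "Well_order r" "Well_order s"
  shows "card_min r s \<le>o r" "card_min r s \<le>o s"
proof -
  note iso = card_min_ordIso[OF assms, THEN ordIso_imp_ordLeq]
  consider "r \<le>o s" | "s \<le>o r" using ordLeq_total[OF assms] by auto
  then have "card_min r s \<le>o r \<and> card_min r s \<le>o s"
  proof cases
    case 1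
    with iso(1)[OF 1] show ?thesis using ordLeq_transitive by auto
  next
    case 2
    with iso(2)[OF 2] show ?thesis using ordLeq_transitive by auto
  qed
  then show "card_min r s \<le>o r" "card_min r s \<le>o s" by simp_all
qed

theorem theorem3p3:
  shows "card_min evasion_number_omega cov_meager \<le>o evasion_number \<and>
    (evasion_number <o cov_meager \<or> evasion_number_omega \<le>o cov_meager \<longrightarrow>
       evasion_number =o evasion_number_omega)"
proof (intro conjI impI)
  show "card_min evasion_number_omega cov_meager \<le>o evasion_number"
    using omega_le_or_cov_le
      card_min_le[OF Well_order_evasion_number_omega Well_order_cov_meager]
    by (auto intro: ordLeq_transitive)
next
  assume "evasion_number <o cov_meager \<or> evasion_number_omega \<le>o cov_meager"
  \<comment> \<open>The alternative cov(M) \<le> e contradicts e < cov(M), and yields the claim by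
    transitivity when e(\<omega>) \<le> cov(M).\<close>
  then have "evasion_number_omega \<le>o evasion_number"
    using omega_le_or_cov_le by (auto dest: not_ordLess_ordLeq intro: ordLeq_transitive)
  then show "evasion_number =o evasion_number_omega"
    using evasion_number_le_omega by (simp add: ordIso_iff_ordLeq)
qed

end
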